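(* Let $c,b\ge2$ be integers and suppose $\log_b c=\frac pq$ with integers $p,q\ge1$, $\gcd(p,q)=1$. There is a unique integer $d\ge2$ such that $c=d^p$ and $b=d^q$, and $$\mathcal S_{c,b}=\{d^n:n\ge0,\ n\equiv p d^n\pmod q\}.$$ Moreover, the congruence $n\equiv pd^n\pmod q$ is eventually periodic in $n$ and has exactly a proportion $1/q$ of solutions in every full eventual period. In particular, $$A_{c,b}(X)=\frac{\log X}{q\log d}+O_{c,b}(1)=\log_bX+O_{c,b}(1),$$ so $\mathcal S_{c,b}$ is infinite.
   Context: $\mathcal S_{c,b}$ is the set of integers $m\ge1$ for which there is an integer $k\ge0$ with $mb^k\le c^m<(m+1)b^k$, and $A_{c,b}(X)=\#(\mathcal S_{c,b}\cap[1,X])$. *)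

theory Defs
  imports Complex_Main "HOL-Number_Theory.Cong"
begin

definition S_set :: "nat \<Rightarrow> nat \<Rightarrow> nat set" where
  "S_set c b = {m. m \<ge> 1 \<and> (\<exists>k::nat. m * b ^ k \<le> c ^ m \<and> c ^ m < (m + 1) * b ^ k)}"

definition A_count :: "nat \<Rightarrow> nat \<Rightarrow> real \<Rightarrow> nat" where
  "A_count c b X = card {m \<in> S_set c b. 1 \<le> real m \<and> real m \<le> X}"

text \<open>\<open>T\<close> is any period, not necessarily the least one, and \<open>N\<close> any index from which it is valid.\<close>

definition periodic_from :: "(nat \<Rightarrow> bool) \<Rightarrow> nat \<Rightarrow> nat \<Rightarrow> bool" where
  "periodic_from P N T \<longleftrightarrow> T \<ge> 1 \<and> (\<forall>n\<ge>N. P (n + T) \<longleftrightarrow> P n)"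

end

theory Submission
  imports Defs "HOL-Computational_Algebra.Nth_Powers"
begin

text \<open>
  The hypothesis on the logarithm says \<open>c ^ q = b ^ p\<close>.  Comparing the multiplicities of each
  prime on both sides, coprimality of \<open>p\<close> and \<open>q\<close> makes \<open>c\<close> a \<open>p\<close>-th power \<open>d ^ p\<close>, and then
  \<open>b = d ^ q\<close>.  Now \<open>m * b ^ k \<le> c ^ m < (m + 1) * b ^ k\<close> says that \<open>m\<close> is the integer part of
  \<open>d\<close> to the exponent \<open>p * m - q * k\<close>.  As \<open>m \<ge> 1\<close>, this exponent is some \<open>n \<ge> 0\<close>, the integer
  part is the power itself, and \<open>m = d ^ n\<close> with \<open>n = p * d ^ n - q * k\<close>.  This is the
  description of the set by the congruence \<open>n \<equiv> p * d ^ n\<close> modulo \<open>q\<close>.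

  The heart of the matter is that this congruence has density \<open>1 / q\<close>
  (\<open>density_power_congruence\<close>), by strong induction on \<open>q\<close>.  Let \<open>\<lambda>\<close> be an eventual
  period of \<open>d ^ n\<close> modulo \<open>q\<close>, and write \<open>n = r + \<lambda> * t\<close> with \<open>r\<close> in a window of length \<open>\<lambda>\<close>.
  For fixed \<open>r\<close> the congruence becomes linear in \<open>t\<close>.  With \<open>g = gcd \<lambda> q\<close>, it is
  solvable exactly if \<open>r \<equiv> p * d ^ r\<close> modulo \<open>g\<close>, and then \<open>g\<close> of the \<open>q\<close> residues \<open>t\<close> solve
  it.  So the density modulo \<open>q\<close> is \<open>g / q\<close> times the density modulo \<open>g\<close>.  By the
  pigeonhole principle \<open>\<lambda>\<close> can be chosen below \<open>q\<close>; hence \<open>g < q\<close>, the density modulo \<open>g\<close> is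
  \<open>1 / g\<close>, and the product is \<open>1 / q\<close>.

  Finally, the number of solutions \<open>n < M\<close> minus \<open>M / q\<close> is an eventually periodic function of
  \<open>M\<close>, hence bounded; with \<open>M\<close> close to the logarithm of \<open>X\<close> to base \<open>d\<close> this gives the
  asymptotics of the counting function, and with them infinitude.
\<close>

section \<open>Counting the values of an eventually periodic predicate\<close>

definition hits :: "(nat \<Rightarrow> bool) \<Rightarrow> nat \<Rightarrow> nat \<Rightarrow> nat" where
  "hits P a b = card {n \<in> {a..<b}. P n}"

lemma hits_eq_sum: "hits P a b = (\<Sum>n = a..<b. of_bool (P n))"
  by (simp add: hits_def Int_def)

lemma hits_append: "a \<le> b \<Longrightarrow> b \<le> c \<Longrightarrow> hits P a c = hits P a b + hits P b c"
  by (simp add: hits_eq_sum sum.atLeastLessThan_concat del: sum_of_bool_eq)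

lemma hits_Suc: "a \<le> b \<Longrightarrow> hits P a (Suc b) = hits P a b + of_bool (P b)"
  by (simp add: hits_eq_sum)

lemma hits_shift:
  assumes "periodic_from P N T" "N \<le> M"
  shows "hits P M (M + T) = hits P N (N + T)"
  using assms(2)
proof (induction M rule: dec_induct)
  case (step M)
  have "hits P M (Suc M + T) = hits P M (Suc M) + hits P (Suc M) (Suc M + T)"
    by (rule hits_append) auto
  moreover have "hits P M (Suc M + T) = hits P M (M + T) + of_bool (P (M + T))"
    by (simp add: hits_Suc)
  moreover have "hits P M (Suc M) = of_bool (P M)"
    by (simp add: hits_eq_sum)
  moreover have "P (M + T) = P M"
    using assms(1) step by (simp add: periodic_from_def)
  ultimately show ?case using step by simp
qed simp

lemma hits_multiple_period:
  assumes "periodic_from P N T" "N \<le> M"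
  shows "hits P M (M + k * T) = k * hits P N (N + T)"
proof (induction k)
  case (Suc k)
  have "hits P M (M + Suc k * T) = hits P M (M + k * T) + hits P (M + k * T) (M + k * T + T)"
    by (subst hits_append[of M "M + k * T"]) (auto simp: algebra_simps)
  then show ?case using Suc hits_shift[OF assms(1), of "M + k * T"] assms(2) by simp
qed (simp add: hits_def)

text \<open>Both sides count the hits in one window whose length is the product of the periods.  So
  the density of an eventually periodic predicate may be computed with any period.\<close>

lemma hits_density_unique:
  assumes "periodic_from P N T" "periodic_from P N' T'"
  shows "hits P N (N + T) * T' = hits P N' (N' + T') * T"
  using hits_multiple_period[OF assms(1), of "max N N'" T']
    hits_multiple_period[OF assms(2), of "max N N'" T]
  by (simp add: mult.commute)

text \<open>The discrepancy is itself eventually periodic in \<open>M\<close>, so it takes only finitely many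
  values.\<close>

lemma hits_discrepancy_bounded:
  assumes per: "periodic_from P N T" and dens: "hits P N (N + T) * q = T" and q: "q \<ge> 1"
  shows "\<exists>C. \<forall>M. \<bar>real (hits P 0 M) - real M / real q\<bar> \<le> C"
proof -
  define F where "F M = real (hits P 0 M) - real M / real q" for M
  have F_period: "F (M + T) = F M" if "N \<le> M" for M
  proof -
    have "hits P 0 (M + T) = hits P 0 M + hits P N (N + T)"
      using hits_append[of 0 M "M + T"] hits_shift[OF per that] by simp
    moreover have "real (hits P N (N + T)) * real q = real T"
      using dens by (metis of_nat_mult)
    ultimately show ?thesis using q by (simp add: F_def field_simps)
  qed
  have T: "T \<ge> 1" using per by (simp add: periodic_from_def)
  have F_reduce: "F M \<in> F ` {..<N + T}" for M
  proof (induction M rule: less_induct)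
    case (less M)
    show ?case
    proof (cases "M < N + T")
      case False
      then have "F M = F (M - T)" using F_period[of "M - T"] by simp
      then show ?thesis using less[of "M - T"] False T by simp
    qed simp
  qed
  have "\<bar>F M\<bar> \<le> Max ((\<lambda>x. \<bar>x\<bar>) ` F ` {..<N + T})" for M
    using F_reduce by (intro Max_ge) auto
  then show ?thesis by (auto simp: F_def)
qed

lemma hits_grid:
  "hits P N (N + l * q) = (\<Sum>r = N..<N + l. card {t \<in> {..<q}. P (r + l * t)})"
proof (induction q)
  case (Suc q)
  have "hits P N (N + l * Suc q) = hits P N (N + l * q) + hits P (N + l * q) (N + l * q + l)"
    by (subst hits_append[of N "N + l * q"]) (auto simp: algebra_simps)
  also have "hits P (N + l * q) (N + l * q + l) = (\<Sum>r = N..<N + l. of_bool (P (r + l * q)))"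
    using sum.shift_bounds_nat_ivl[of "\<lambda>n. of_bool (P n) :: nat" N "l * q" "N + l"]
    by (simp add: hits_eq_sum algebra_simps)
  also have "hits P N (N + l * q) + \<dots> =
      (\<Sum>r = N..<N + l. card {t \<in> {..<q}. P (r + l * t)} + of_bool (P (r + l * q)))"
    by (simp add: Suc sum.distrib del: sum_of_bool_eq)
  also have "\<dots> = (\<Sum>r = N..<N + l. card {t \<in> {..<Suc q}. P (r + l * t)})"
    using hits_Suc[of 0 q "\<lambda>t. P (r + l * t)" for r] by (simp add: hits_def atLeast0LessThan)
  finally show ?case .
qed (simp add: hits_def)

section \<open>The density of solutions of the congruence\<close>

lemma card_solutions_linear_congruence:
  fixes l q r a :: nat
  assumes "q \<ge> 1"
  shows "card {t \<in> {..<q}. [r + l * t = a] (mod q)} =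
    (if [r = a] (mod gcd l q) then gcd l q else 0)"
proof -
  define g where "g = gcd l q"
  have g: "g \<ge> 1" using assms by (simp add: g_def Suc_le_eq)
  obtain l1 q1 where l1: "l = g * l1" and q1: "q = g * q1" and cop: "coprime l1 q1"
    using gcd_coprime_exists[of l q] g unfolding g_def by (metis mult.commute not_one_le_zero)
  have "q1 \<ge> 1" using q1 assms by (cases q1) auto
  show ?thesis
  proof (cases "[r = a] (mod g)")
    case True
    have "int g dvd int a - int r"
      using True by (metis cong_iff_dvd_diff cong_int_iff cong_sym)
    then have "gcd (int l) (int q) dvd int a - int r" by (simp add: g_def)
    from cong_solve_dvd_int[OF this] obtain x where x: "[int l * x = int a - int r] (mod int q)"
      by blast
    define t0 where "t0 = nat (x mod int q)"
    have "int t0 = x mod int q" using assms by (simp add: t0_def)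
    then have "[int l * int t0 = int l * x] (mod int q)"
      by (simp add: cong_def mod_mult_right_eq)
    then have "[int l * int t0 = int a - int r] (mod int q)" using x by (rule cong_trans)
    then have "[int r + int l * int t0 = int r + (int a - int r)] (mod int q)"
      by (simp only: cong_add_lcancel)
    then have "[int (r + l * t0) = int a] (mod int q)" by simp
    then have t0: "[r + l * t0 = a] (mod q)" by (simp only: cong_int_iff)
    have sol: "[r + l * t = a] (mod q) \<longleftrightarrow> [t = t0] (mod q1)" for t
    proof -
      have "[r + l * t = a] (mod q) \<longleftrightarrow> [r + l * t = r + l * t0] (mod q)"
        using t0 cong_trans cong_sym by blast
      also have "\<dots> \<longleftrightarrow> [g * (l1 * t) = g * (l1 * t0)] (mod g * q1)"
        by (simp add: cong_add_lcancel_nat l1 q1 mult.assoc)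
      also have "\<dots> \<longleftrightarrow> [l1 * t = l1 * t0] (mod q1)"
        using g by (auto simp: cong_def)
      also have "\<dots> \<longleftrightarrow> [t = t0] (mod q1)" using cop by (rule cong_mult_lcancel_nat)
      finally show ?thesis .
    qed
    define Q where "Q = (\<lambda>t. [t = t0] (mod q1))"
    have per: "periodic_from Q 0 q1"
      using \<open>q1 \<ge> 1\<close> by (simp add: periodic_from_def Q_def cong_def)
    \<comment> \<open>In a window of length \<open>q1\<close> that starts at \<open>t0\<close>, only \<open>t0\<close> itself is a solution.\<close>
    have "{t \<in> {t0..<t0 + q1}. Q t} = {t0}"
    proof -
      have "t = t0" if "t0 \<le> t" "t < t0 + q1" "[t = t0] (mod q1)" for t
        using that by (auto simp: cong_altdef_nat dest: dvd_imp_le)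
      then show ?thesis using \<open>q1 \<ge> 1\<close> by (auto simp: Q_def)
    qed
    then have "hits Q 0 q1 = 1" using hits_shift[OF per, of t0] by (simp add: hits_def)
    then have "hits Q 0 q = g" using hits_multiple_period[OF per, of 0 g] by (simp add: q1)
    then show ?thesis using True by (simp add: sol hits_def Q_def g_def atLeast0LessThan)
  next
    case False
    have "\<not> [r + l * t = a] (mod q)" for t
    proof
      assume "[r + l * t = a] (mod q)"
      then have "[r + l * t = a] (mod g)" by (rule cong_dvd_modulus_nat) (simp add: g_def)
      then show False using False by (simp add: l1 cong_def mult.assoc)
    qed
    then show ?thesis using False by (simp add: g_def)
  qed
qed

text \<open>The strict bound \<open>l < q\<close> makes the induction on the modulus work.  It comes from the residue
  \<open>0\<close>: either some power reaches it, and the powers are constant from there on, or at most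
  \<open>q - 1\<close> residues are available to the first \<open>q\<close> powers.\<close>

lemma power_mod_eventually_periodic:
  fixes d q :: nat
  assumes "q > 1"
  obtains N l where "1 \<le> l" "l < q" "\<And>n. n \<ge> N \<Longrightarrow> [d ^ (n + l) = d ^ n] (mod q)"
proof (cases "\<exists>i. q dvd d ^ i")
  case True
  then obtain i where "q dvd d ^ i" by blast
  then have "q dvd d ^ n" if "n \<ge> i" for n
    using that by (meson dvd_trans le_imp_power_dvd)
  then show thesis using assms by (intro that[of 1 i]) (simp_all add: cong_def mod_eq_0_iff_dvd)
next
  case False
  have "(\<lambda>i. d ^ i mod q) ` {..<q} \<subseteq> {1..<q}"
    using False assms by (auto simp: Suc_le_eq mod_greater_zero_iff_not_dvd)
  then have "card ((\<lambda>i. d ^ i mod q) ` {..<q}) < card {..<q}"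
    using card_mono[of "{1..<q}" "(\<lambda>i. d ^ i mod q) ` {..<q}"] assms by simp
  then have "\<not> inj_on (\<lambda>i. d ^ i mod q) {..<q}" by (rule pigeonhole)
  then obtain i j where ij: "i < j" "j < q" "d ^ i mod q = d ^ j mod q"
    by (auto simp: inj_on_def) (metis linorder_neqE_nat)
  have "[d ^ (n + (j - i)) = d ^ n] (mod q)" if "n \<ge> i" for n
  proof -
    have "[d ^ (n - i) * d ^ j = d ^ (n - i) * d ^ i] (mod q)"
      using ij by (intro cong_mult cong_refl) (simp add: cong_def)
    then show ?thesis using that ij by (simp flip: power_add)
  qed
  then show thesis using ij by (intro that[of "j - i" i]) auto
qed

lemma power_congruence_periodic:
  fixes d p q l :: nat
  assumes "l \<ge> 1" "q \<ge> 1" and per: "\<And>n. n \<ge> N \<Longrightarrow> [d ^ (n + l) = d ^ n] (mod q)"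
  shows "periodic_from (\<lambda>n. [n = p * d ^ n] (mod q)) N (l * q)"
    and "n \<ge> N \<Longrightarrow> [p * d ^ (n + l * t) = p * d ^ n] (mod q)"
proof -
  show *: "[p * d ^ (n + l * t) = p * d ^ n] (mod q)" if "n \<ge> N" for n t
  proof (induction t)
    case (Suc t)
    have "[p * d ^ (n + l * t + l) = p * d ^ (n + l * t)] (mod q)"
      using per[of "n + l * t"] that by (intro cong_mult cong_refl) auto
    then show ?case using Suc by (auto simp: algebra_simps intro: cong_trans)
  qed simp
  have "[n + l * q = p * d ^ (n + l * q)] (mod q) \<longleftrightarrow> [n = p * d ^ n] (mod q)"
    if "n \<ge> N" for n
    using *[OF that, of q] by (simp add: cong_def)
  then show "periodic_from (\<lambda>n. [n = p * d ^ n] (mod q)) N (l * q)"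
    using assms by (simp add: periodic_from_def Suc_le_eq)
qed

lemma ex_period_power_congruence:
  fixes d p q :: nat
  assumes "q \<ge> 1"
  shows "\<exists>N T. periodic_from (\<lambda>n. [n = p * d ^ n] (mod q)) N T"
proof (cases "q = 1")
  case True
  then show ?thesis by (auto simp: periodic_from_def)
next
  case False
  then obtain N l where "1 \<le> l" "\<And>n. n \<ge> N \<Longrightarrow> [d ^ (n + l) = d ^ n] (mod q)"
    using power_mod_eventually_periodic[of q d] assms by (metis le_neq_implies_less)
  then show ?thesis using power_congruence_periodic(1)[of l q N d p] assms by blast
qed

text \<open>An eventual period \<open>l\<close> of the powers of \<open>d\<close> modulo \<open>q\<close> is, for \<open>g = gcd l q\<close>, an eventual
  period of the whole congruence modulo \<open>g\<close>, because \<open>g\<close> divides \<open>l\<close>.  So the induction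
  hypothesis counts the residues \<open>r\<close> that admit a solution \<open>r + l * t\<close> modulo \<open>q\<close>.\<close>

lemma density_power_congruence:
  fixes d p q :: nat
  assumes "q \<ge> 1" "periodic_from (\<lambda>n. [n = p * d ^ n] (mod q)) N T"
  shows "hits (\<lambda>n. [n = p * d ^ n] (mod q)) N (N + T) * q = T"
  using assms
proof (induction q arbitrary: N T rule: less_induct)
  case (less q)
  show ?case
  proof (cases "q = 1")
    case True
    then show ?thesis by (simp add: hits_eq_sum del: sum_of_bool_eq)
  next
    case False
    then have q: "q > 1" using less.prems by simp
    from power_mod_eventually_periodic[OF q, of d] obtain N0 l where
      l: "1 \<le> l" "l < q" and per: "\<And>n. n \<ge> N0 \<Longrightarrow> [d ^ (n + l) = d ^ n] (mod q)"
      by metis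
    define g where "g = gcd l q"
    have "g \<le> l" using l by (auto simp: g_def intro: dvd_imp_le)
    then have g: "g < q" "g \<ge> 1" using l by (linarith, simp add: g_def Suc_le_eq)
    have "[n + l = p * d ^ (n + l)] (mod g) \<longleftrightarrow> [n = p * d ^ n] (mod g)" if "n \<ge> N0" for n
    proof -
      have "[d ^ (n + l) = d ^ n] (mod g)"
        using per[OF that] by (rule cong_dvd_modulus_nat) (simp add: g_def)
      then have "[p * d ^ (n + l) = p * d ^ n] (mod g)" by (intro cong_mult cong_refl)
      moreover have "[n + l = n] (mod g)" by (simp add: cong_add_lcancel_0_nat cong_0_iff g_def)
      ultimately show ?thesis by (simp add: cong_def)
    qed
    then have "periodic_from (\<lambda>n. [n = p * d ^ n] (mod g)) N0 l"
      using l by (simp add: periodic_from_def)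
    note IH = less.IH[OF g this]
    have "hits (\<lambda>n. [n = p * d ^ n] (mod q)) N0 (N0 + l * q) =
        (\<Sum>r = N0..<N0 + l. card {t \<in> {..<q}. [r + l * t = p * d ^ (r + l * t)] (mod q)})"
      by (rule hits_grid)
    also have "\<dots> = (\<Sum>r = N0..<N0 + l. of_bool ([r = p * d ^ r] (mod g)) * g)"
    proof (rule sum.cong[OF refl])
      fix r assume "r \<in> {N0..<N0 + l}"
      then have "[r + l * t = p * d ^ (r + l * t)] (mod q) \<longleftrightarrow> [r + l * t = p * d ^ r] (mod q)"
        for t
        using power_congruence_periodic(2)[of l q N0 d r p t] l q per by (auto simp: cong_def)
      then show "card {t \<in> {..<q}. [r + l * t = p * d ^ (r + l * t)] (mod q)} =
          of_bool ([r = p * d ^ r] (mod g)) * g"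
        using card_solutions_linear_congruence[of q r l "p * d ^ r"] q by (simp add: g_def)
    qed
    also have "\<dots> = hits (\<lambda>n. [n = p * d ^ n] (mod g)) N0 (N0 + l) * g"
      by (simp only: hits_eq_sum sum_distrib_right)
    also have "\<dots> = l" by (rule IH)
    finally have "hits (\<lambda>n. [n = p * d ^ n] (mod q)) N (N + T) * (l * q) = l * T"
      using hits_density_unique[OF less.prems(2)] power_congruence_periodic(1)[of l q N0 d p] l q per
      by simp
    then show ?thesis using l by (simp add: algebra_simps)
  qed
qed

section \<open>The common base and the description of the set\<close>

lemma common_base_of_equal_powers:
  fixes b c p q :: nat
  assumes "c \<ge> 2" "p \<ge> 1" "coprime p q" "c ^ q = b ^ p"
  obtains d where "d \<ge> 2" "c = d ^ p" "b = d ^ q"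
proof -
  have "p dvd multiplicity r c" if "prime r" for r
  proof -
    have "b ^ p > 0" using assms(1) by (simp flip: assms(4))
    then have "b \<noteq> 0" using assms(2) by auto
    moreover have "multiplicity r (c ^ q) = multiplicity r (b ^ p)" using assms(4) by simp
    ultimately have "q * multiplicity r c = p * multiplicity r b"
      using that assms(1) prime_elem_multiplicity_power_distrib[of r] by simp
    then have "p dvd q * multiplicity r c" by simp
    then show ?thesis using assms(3) by (simp add: coprime_dvd_mult_right_iff)
  qed
  then have "is_nth_power p c"
    using assms by (subst is_nth_power_conv_multiplicity_nat) auto
  then obtain d where d: "c = d ^ p" by (rule is_nth_powerE)
  have "b ^ p = (d ^ q) ^ p" using assms(4) by (simp add: d mult.commute flip: power_mult)
  then have "b = d ^ q" using assms(2) by (intro power_eq_imp_eq_base[of b p]) auto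
  moreover have "d \<ge> 2"
  proof (rule ccontr)
    assume "\<not> d \<ge> 2"
    then have "d = 0 \<or> d = 1" by auto
    then show False using assms(1,2) d by (auto simp: zero_power)
  qed
  ultimately show thesis using that d by blast
qed

lemma power_eq_of_log_eq:
  fixes b c p q :: nat
  assumes "c \<ge> 2" "b \<ge> 2" "q \<ge> 1" "log (real b) (real c) = real p / real q"
  shows "c ^ q = b ^ p"
proof -
  have "real q * ln (real c) = real p * ln (real b)"
    using assms by (simp add: log_def field_simps)
  then have "ln (real c ^ q) = ln (real b ^ p)"
    using assms by (simp add: ln_realpow)
  then have "real (c ^ q) = real (b ^ p)"
    using assms by (simp add: ln_inj_iff)
  then show ?thesis by (simp only: of_nat_eq_iff)
qed

lemma S_set_common_base:
  fixes d p q :: nat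
  assumes d: "d \<ge> 2" and "p \<ge> 1"
  shows "S_set (d ^ p) (d ^ q) = {d ^ n | n. [n = p * d ^ n] (mod q)}"
proof (intro equalityI subsetI)
  fix m assume "m \<in> S_set (d ^ p) (d ^ q)"
  then obtain k where m: "m \<ge> 1" and lo: "m * d ^ (q * k) \<le> d ^ (p * m)"
    and hi: "d ^ (p * m) < (m + 1) * d ^ (q * k)"
    by (auto simp: S_set_def simp flip: power_mult)
  have "d ^ (q * k) \<le> m * d ^ (q * k)" using m by (cases m) auto
  also note lo
  finally have "d ^ (q * k) \<le> d ^ (p * m)" .
  then have le: "q * k \<le> p * m" using d by simp
  define n where "n = p * m - q * k"
  have "d ^ (p * m) = d ^ n * d ^ (q * k)" using le by (simp add: n_def flip: power_add)
  then have "m \<le> d ^ n" "d ^ n < m + 1"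
    using lo hi d by (simp_all only: mult_le_cancel2 mult_less_cancel2)
  then have mn: "m = d ^ n" by simp
  have "p * m = n + q * k" using le by (simp add: n_def)
  then have "[n = p * d ^ n] (mod q)" by (simp add: mn[symmetric] cong_def)
  then show "m \<in> {d ^ n | n. [n = p * d ^ n] (mod q)}" using mn by blast
next
  fix m assume "m \<in> {d ^ n | n. [n = p * d ^ n] (mod q)}"
  then obtain n where m: "m = d ^ n" and cong: "[p * d ^ n = n] (mod q)"
    by (auto intro: cong_sym)
  have "n < d ^ n" using d by (intro less_exp[THEN less_le_trans] power_mono) auto
  also have "d ^ n \<le> p * d ^ n" using assms by simp
  \<comment> \<open>As \<open>n \<le> p * d ^ n\<close>, the congruence gives an exponent \<open>k = (p * d ^ n - n) / q \<ge> 0\<close>.\<close>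
  finally have "q dvd p * d ^ n - n" "n \<le> p * d ^ n" using cong by (auto simp: cong_altdef_nat)
  then obtain k where k: "p * d ^ n = n + q * k" by (metis dvdE le_add_diff_inverse)
  have "(d ^ p) ^ m = m * (d ^ q) ^ k"
    by (simp add: m k power_add flip: power_mult)
  moreover have "m \<ge> 1" "(d ^ q) ^ k > 0" using d by (auto simp: m)
  ultimately show "m \<in> S_set (d ^ p) (d ^ q)" by (auto simp: S_set_def intro!: exI[of _ k])
qed

section \<open>The counting function\<close>

lemma A_count_eq_hits:
  fixes d :: nat
  assumes S: "S_set c b = {d ^ n | n. P n}" and d: "d \<ge> 2" and X: "X \<ge> 1"
  shows "A_count c b X = hits P 0 (nat \<lfloor>log (real d) X\<rfloor> + 1)"
proof -
  have le: "real d ^ n \<le> X \<longleftrightarrow> n < nat \<lfloor>log (real d) X\<rfloor> + 1" for n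
  proof -
    have "real d ^ n \<le> X \<longleftrightarrow> real d powr real n \<le> X" using d by (simp add: powr_realpow)
    also have "\<dots> \<longleftrightarrow> real n \<le> log (real d) X" using d X by (simp add: le_log_iff)
    also have "\<dots> \<longleftrightarrow> n < nat \<lfloor>log (real d) X\<rfloor> + 1"
      using d X by (simp add: less_Suc_eq_le le_nat_floor le_nat_iff le_floor_iff)
    finally show ?thesis .
  qed
  have "{m \<in> S_set c b. 1 \<le> real m \<and> real m \<le> X} =
      (\<lambda>n. d ^ n) ` {n \<in> {0..<nat \<lfloor>log (real d) X\<rfloor> + 1}. P n}"
    using d by (auto simp: S le)
  moreover have "inj (\<lambda>n. d ^ n)" using d by (auto intro!: injI)
  ultimately show ?thesis by (simp add: A_count_def hits_def card_image inj_on_subset)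
qed

lemma A_count_asymptotics:
  fixes d q :: nat
  assumes S: "S_set c b = {d ^ n | n. P n}" and d: "d \<ge> 2" and q: "q \<ge> 1"
    and per: "periodic_from P N T" and dens: "hits P N (N + T) * q = T"
  shows "\<exists>C. \<forall>X\<ge>1. \<bar>real (A_count c b X) - ln X / (real q * ln (real d))\<bar> \<le> C"
proof -
  obtain C where C: "\<And>M. \<bar>real (hits P 0 M) - real M / real q\<bar> \<le> C"
    using hits_discrepancy_bounded[OF per dens q] by blast
  have "\<bar>real (A_count c b X) - ln X / (real q * ln (real d))\<bar> \<le> C + 1" if X: "X \<ge> 1" for X
  proof -
    define M where "M = nat \<lfloor>log (real d) X\<rfloor> + 1"
    have "log (real d) X \<ge> 0" using d X by simp
    then have "\<bar>real M - log (real d) X\<bar> \<le> 1" unfolding M_def by linarith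
    moreover have "\<bar>real M - log (real d) X\<bar> / real q \<le> \<bar>real M - log (real d) X\<bar> / 1"
      using q by (intro divide_left_mono) auto
    ultimately have "\<bar>real M / real q - log (real d) X / real q\<bar> \<le> 1"
      by (simp flip: diff_divide_distrib)
    moreover have "log (real d) X / real q = ln X / (real q * ln (real d))"
      by (simp add: log_def mult.commute)
    moreover have "A_count c b X = hits P 0 M"
      unfolding M_def by (rule A_count_eq_hits[OF S d X])
    ultimately show ?thesis using C[of M] by simp
  qed
  then show ?thesis by blast
qed

lemma infinite_if_A_count_logarithmic:
  assumes b: "b \<ge> 2" and C: "\<And>X. X \<ge> 1 \<Longrightarrow> \<bar>real (A_count c b X) - log (real b) X\<bar> \<le> C"
  shows "infinite (S_set c b)"
proof
  assume fin: "finite (S_set c b)"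
  define x where "x = real (card (S_set c b)) + \<bar>C\<bar> + 1"
  have "x \<ge> 0" by (simp add: x_def)
  then have "real b powr x \<ge> 1" using b by (simp add: ge_one_powr_ge_zero)
  from C[OF this] have "real (A_count c b (real b powr x)) \<ge> x - C" using b by simp
  moreover have "A_count c b (real b powr x) \<le> card (S_set c b)"
    unfolding A_count_def using fin by (intro card_mono) auto
  ultimately show False by (simp add: x_def)
qed

theorem theorem5p10:
  fixes c b p q :: nat
  assumes "c \<ge> 2" and "b \<ge> 2"
    and "p \<ge> 1" and "q \<ge> 1" and "coprime p q"
    and "log (real b) (real c) = real p / real q"
  shows "(\<exists>!d::nat. d \<ge> 2 \<and> c = d ^ p \<and> b = d ^ q) \<and>
    (\<forall>d::nat. d \<ge> 2 \<and> c = d ^ p \<and> b = d ^ q \<longrightarrow>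
      S_set c b = {d ^ n | n::nat. [n = p * d ^ n] (mod q)} \<and>
      (\<exists>N T. periodic_from (\<lambda>n. [n = p * d ^ n] (mod q)) N T) \<and>
      (\<forall>N T. periodic_from (\<lambda>n. [n = p * d ^ n] (mod q)) N T \<longrightarrow>
        real (card {n \<in> {N..<N + T}. [n = p * d ^ n] (mod q)}) / real T = 1 / real q) \<and>
      (\<exists>C::real. \<forall>X::real. X \<ge> 1 \<longrightarrow>
        \<bar>real (A_count c b X) - ln X / (real q * ln (real d))\<bar> \<le> C)) \<and>
    (\<exists>C::real. \<forall>X::real. X \<ge> 1 \<longrightarrow> \<bar>real (A_count c b X) - log (real b) X\<bar> \<le> C) \<and>
    infinite (S_set c b)"
proof -
  let ?P = "\<lambda>d n. [n = p * d ^ n] (mod q)"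
  obtain d where d: "d \<ge> 2" "c = d ^ p" "b = d ^ q"
    using common_base_of_equal_powers power_eq_of_log_eq assms by metis
  have unique: "e = d" if "c = e ^ p" for e
    using that d assms(3) by (intro power_eq_imp_eq_base[of e p d]) auto
  have S: "S_set c b = {d ^ n | n. ?P d n}"
    using S_set_common_base d assms by simp
  obtain N T where per: "periodic_from (?P d) N T"
    using ex_period_power_congruence[OF assms(4)] by blast
  have proportion: "real (card {n \<in> {N..<N + T}. ?P d n}) / real T = 1 / real q"
    if per': "periodic_from (?P d) N T" for N T
  proof -
    have "real (hits (?P d) N (N + T)) * real q = real T"
      using density_power_congruence[OF assms(4) per'] by (metis of_nat_mult)
    moreover have "T \<ge> 1" using per' by (simp add: periodic_from_def)
    ultimately show ?thesis using assms(4) by (simp add: hits_def field_simps)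
  qed
  have asymp_d: "\<exists>C. \<forall>X\<ge>1. \<bar>real (A_count c b X) - ln X / (real q * ln (real d))\<bar> \<le> C"
    using A_count_asymptotics[OF S d(1) assms(4) per] density_power_congruence[OF assms(4) per] .
  have "log (real b) X = ln X / (real q * ln (real d))" for X
    using d by (simp add: log_def ln_realpow)
  then have asymp_b: "\<exists>C. \<forall>X\<ge>1. \<bar>real (A_count c b X) - log (real b) X\<bar> \<le> C"
    using asymp_d by simp
  then have "infinite (S_set c b)"
    using infinite_if_A_count_logarithmic assms(2) by blast
  moreover have "\<exists>!d. d \<ge> 2 \<and> c = d ^ p \<and> b = d ^ q"
    using d unique by blast
  moreover have "S_set c b = {e ^ n | n. ?P e n} \<and>
      (\<exists>N T. periodic_from (?P e) N T) \<and>
      (\<forall>N T. periodic_from (?P e) N T \<longrightarrow>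
        real (card {n \<in> {N..<N + T}. ?P e n}) / real T = 1 / real q) \<and>
      (\<exists>C. \<forall>X\<ge>1. \<bar>real (A_count c b X) - ln X / (real q * ln (real e))\<bar> \<le> C)"
    if "e \<ge> 2 \<and> c = e ^ p \<and> b = e ^ q" for e
  proof -
    have "e = d" using that unique by simp
    then show ?thesis using S per proportion asymp_d by blast
  qed
  ultimately show ?thesis using asymp_b by blast
qed

end
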